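(* Let $k \geq 4$ be an even integer. Then $h(n,k) \leq \frac{n(3k+8)(k-2)}{4(3k-4)}$ for every positive integer $n$ with $n \equiv 0 \pmod{\frac{3k-4}{2}}$.
   Context: All graphs are finite and simple. A degree monotone path in a graph $G$ is a path $v_1v_2\ldots v_m$ such that $\deg(v_1)\le \cdots\le \deg(v_m)$ or $\deg(v_1)\ge \cdots\ge \deg(v_m)$; its length is its number of vertices. $mp(G)$ denotes the maximum length of a degree monotone path in $G$. For a pair $e$ of non-adjacent vertices, $G+e$ is $G$ with the edge $e$ added. A graph $G$ is $k$-saturated if $mp(G)\le k-1$ and $mp(G+e)\ge k$ for every pair $e$ of non-adjacent vertices of $G$ (so $K_m$ is $k$-saturated for $m\le k-1$). $h(n,k)$ is the minimum number of edges of a $k$-saturated graph on $n$ vertices. *)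

theory Defs
  imports Complex_Main
begin

definition simple_graph :: "'a set \<Rightarrow> 'a set set \<Rightarrow> bool" where
  "simple_graph V E \<longleftrightarrow> finite V \<and> E \<subseteq> {{u, v} | u v. u \<in> V \<and> v \<in> V \<and> u \<noteq> v}"

definition deg :: "'a set set \<Rightarrow> 'a \<Rightarrow> nat" where
  "deg E v = card {u. {u, v} \<in> E}"

definition is_path :: "'a set \<Rightarrow> 'a set set \<Rightarrow> 'a list \<Rightarrow> bool" where
  "is_path V E p \<longleftrightarrow> p \<noteq> [] \<and> distinct p \<and> set p \<subseteq> V \<and>
     (\<forall>i. i + 1 < length p \<longrightarrow> {p ! i, p ! (i + 1)} \<in> E)"

definition deg_monotone :: "'a set set \<Rightarrow> 'a list \<Rightarrow> bool" where
  "deg_monotone E p \<longleftrightarrow> sorted (map (deg E) p) \<or> sorted (rev (map (deg E) p))"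

definition mp :: "'a set \<Rightarrow> 'a set set \<Rightarrow> nat" where
  "mp V E = Max {length p | p. is_path V E p \<and> deg_monotone E p}"

definition k_saturated :: "'a set \<Rightarrow> 'a set set \<Rightarrow> nat \<Rightarrow> bool" where
  "k_saturated V E k \<longleftrightarrow> mp V E \<le> k - 1 \<and>
     (\<forall>u\<in>V. \<forall>v\<in>V. u \<noteq> v \<and> {u, v} \<notin> E \<longrightarrow> mp V (insert {u, v} E) \<ge> k)"

text \<open>h(n,k): minimum number of edges of a k-saturated graph on n vertices
  (vertex set {0..<n}, WLOG up to isomorphism).\<close>
definition h :: "nat \<Rightarrow> nat \<Rightarrow> nat" where
  "h n k = Min {card E | E. simple_graph {0..<n} E \<and> k_saturated {0..<n} E k}"

end

theory Submission
  imports Defs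
begin

text \<open>
  Write \<open>k = 2 s + 2\<close> and \<open>n = (3 s + 1) t\<close>. Take \<open>t\<close> blocks, each made of two cliques \<open>K\<^sub>s\<close> of low
  degree \<open>s + 1\<close> and one clique \<open>K\<^sub>s\<^sub>+\<^sub>1\<close> of middle degree \<open>s + 2\<close>, where every low vertex has one
  matching neighbour in the middle clique of its block, and one further neighbour: the last middle
  vertex of its own block for index 0, and otherwise the hub, which is the last middle vertex of
  block 0 and has the largest degree. A path with increasing degrees stays in one low clique and
  then in one middle clique, so it has at most \<open>s + (s + 1) = k - 1\<close> vertices. A new edge raises
  two degrees, and this always allows such a path to be extended by one vertex: by inserting a low
  vertex, whose degree has become \<open>s + 2\<close>, before or after the middle clique, or by a middle vertex
  of another block.
\<close>

section \<open>Degree monotone paths and \<open>mp\<close>\<close>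

lemma is_path_iff_successively:
  "is_path V E p \<longleftrightarrow>
     p \<noteq> [] \<and> distinct p \<and> set p \<subseteq> V \<and> successively (\<lambda>u v. {u, v} \<in> E) p"
  by (simp add: is_path_def successively_conv_nth)

lemma finite_monotone_path_lengths:
  assumes "finite V"
  shows "finite {length p | p. is_path V E p \<and> deg_monotone E p}"
proof (rule finite_subset)
  show "{length p | p. is_path V E p \<and> deg_monotone E p} \<subseteq> {..card V}"
    using assms by (auto simp: is_path_def card_mono simp flip: distinct_card)
qed simp

lemma length_le_mp:
  assumes "finite V" "is_path V E p" "deg_monotone E p"
  shows "length p \<le> mp V E"
  unfolding mp_def using assms by (intro Max_ge finite_monotone_path_lengths) auto

text \<open>Reversing a path with decreasing degrees gives one with increasing degrees, so only the
  latter have to be bounded. A vertex supplies a one-vertex path, so that \<open>Max\<close> ranges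
  over a nonempty set.\<close>

lemma mp_leI:
  assumes "finite V" "V \<noteq> {}"
    and "\<And>p. is_path V E p \<Longrightarrow> sorted (map (deg E) p) \<Longrightarrow> length p \<le> l"
  shows "mp V E \<le> l"
proof -
  let ?S = "{length p | p. is_path V E p \<and> deg_monotone E p}"
  obtain v where "v \<in> V"
    using assms(2) by blast
  then have "is_path V E [v] \<and> deg_monotone E [v]"
    by (simp add: is_path_def deg_monotone_def)
  then have "?S \<noteq> {}"
    by blast
  moreover have "length p \<le> l" if p: "is_path V E p" "deg_monotone E p" for p
  proof (cases "sorted (map (deg E) p)")
    case True
    then show ?thesis using p assms(3) by blast
  next
    case False
    then have "sorted (map (deg E) (rev p))"
      using p by (simp add: deg_monotone_def rev_map)
    moreover have "is_path V E (rev p)"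
      using p(1) by (simp add: is_path_iff_successively insert_commute)
    ultimately have "length (rev p) \<le> l"
      by (rule assms(3)[rotated])
    then show ?thesis by simp
  qed
  ultimately show ?thesis
    unfolding mp_def using finite_monotone_path_lengths[OF assms(1)]
    by (subst Max_le_iff) auto
qed

section \<open>Isomorphism invariance and upper bounds for \<open>h\<close>\<close>

lemma finite_edges: "simple_graph V E \<Longrightarrow> finite E"
  unfolding simple_graph_def by (rule finite_subset[of _ "Pow V"]) auto

lemma edge_in_image_iff:
  assumes "inj_on f V" "E \<subseteq> Pow V" "u \<in> V" "v \<in> V"
  shows "{f u, f v} \<in> (`) f ` E \<longleftrightarrow> {u, v} \<in> E"
  using inj_on_image_mem_iff[OF inj_on_image_Pow[OF assms(1)], of "{u, v}" E] assms(2-4) by simp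

lemma deg_image:
  assumes "inj_on f V" "E \<subseteq> Pow V" "v \<in> V"
  shows "deg ((`) f ` E) (f v) = deg E v"
proof -
  have "{u. {u, f v} \<in> (`) f ` E} = f ` {u. {u, v} \<in> E}" (is "?L = ?R")
  proof
    show "?L \<subseteq> ?R"
    proof
      fix w assume "w \<in> ?L"
      then obtain e where e: "e \<in> E" "{w, f v} = f ` e" by auto
      then obtain u where "u \<in> e" "w = f u" by blast
      with e assms edge_in_image_iff[of f V E u v] show "w \<in> ?R" by blast
    qed
    show "?R \<subseteq> ?L"
    proof clarify
      fix u assume "{u, v} \<in> E"
      then have "f ` {u, v} \<in> (`) f ` E" by (rule imageI)
      then show "{f u, f v} \<in> (`) f ` E" by simp
    qed
  qed
  moreover have "inj_on f {u. {u, v} \<in> E}"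
    using assms(1,2) by (auto intro: inj_on_subset)
  ultimately show ?thesis
    by (simp add: deg_def card_image)
qed

text \<open>Adjacency and degrees are preserved by an injective map, and every path in the image
  pulls back along \<open>inv_into V f\<close>; hence both graphs have the same set of monotone path
  lengths.\<close>

lemma mp_image:
  assumes inj: "inj_on f V" and E: "E \<subseteq> Pow V"
  shows "mp (f ` V) ((`) f ` E) = mp V E"
proof -
  have path: "is_path (f ` V) ((`) f ` E) (map f p) \<longleftrightarrow> is_path V E p" if "set p \<subseteq> V" for p
  proof -
    have "successively (\<lambda>u v. {f u, f v} \<in> (`) f ` E) p \<longleftrightarrow> successively (\<lambda>u v. {u, v} \<in> E) p"
    proof (rule successively_cong)
      fix u v assume "u \<in> set p" "v \<in> set p"
      then show "{f u, f v} \<in> (`) f ` E \<longleftrightarrow> {u, v} \<in> E"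
        using that by (intro edge_in_image_iff[OF assms]) auto
    qed simp
    then show ?thesis
      using that inj
      by (auto simp: is_path_iff_successively distinct_map successively_map intro: inj_on_subset)
  qed
  have mono: "deg_monotone ((`) f ` E) (map f p) \<longleftrightarrow> deg_monotone E p" if "set p \<subseteq> V" for p
  proof -
    have "map (deg ((`) f ` E)) (map f p) = map (deg E) p"
      using that deg_image[OF assms] by auto
    then show ?thesis by (simp only: deg_monotone_def)
  qed
  have "{length q | q. is_path (f ` V) ((`) f ` E) q \<and> deg_monotone ((`) f ` E) q}
      = {length p | p. is_path V E p \<and> deg_monotone E p}" (is "?L = ?R")
  proof
    show "?L \<subseteq> ?R"
    proof
      fix l assume "l \<in> ?L"
      then obtain q where q: "l = length q" "is_path (f ` V) ((`) f ` E) q"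
        "deg_monotone ((`) f ` E) q" by blast
      have "set q \<subseteq> f ` V" using q by (simp add: is_path_def)
      have "set (map (inv_into V f) q) \<subseteq> V"
        using \<open>set q \<subseteq> f ` V\<close> by (auto intro: inv_into_into)
      moreover have "map f (map (inv_into V f) q) = q"
        using \<open>set q \<subseteq> f ` V\<close> by (simp add: map_idI f_inv_into_f subset_iff)
      ultimately obtain p where p: "set p \<subseteq> V" "map f p = q" by blast
      then show "l \<in> ?R"
        using q path[OF p(1)] mono[OF p(1)]
        by (intro CollectI exI[of _ p]) auto
    qed
    show "?R \<subseteq> ?L"
    proof
      fix l assume "l \<in> ?R"
      then obtain p where p: "l = length p" "is_path V E p" "deg_monotone E p" by blast
      then have "set p \<subseteq> V" by (simp add: is_path_def)
      with p path mono have "is_path (f ` V) ((`) f ` E) (map f p)"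
        "deg_monotone ((`) f ` E) (map f p)" by auto
      with p show "l \<in> ?L" by (intro CollectI exI[of _ "map f p"]) simp
    qed
  qed
  then show ?thesis by (simp add: mp_def)
qed

text \<open>As \<open>h\<close> only sees graphs on \<open>{0..<n}\<close>, a saturated graph on any
  vertex type is first carried over along a bijection.\<close>

lemma h_le_card_edges:
  fixes V :: "'a set"
  assumes G: "simple_graph V E" and sat: "k_saturated V E k"
  shows "h (card V) k \<le> card E"
proof -
  let ?n = "card V"
  obtain f where f: "bij_betw f V {0..<?n}"
    using G ex_bij_betw_finite_nat by (auto simp: simple_graph_def)
  then have inj: "inj_on f V" and img: "f ` V = {0..<?n}"
    by (auto simp: bij_betw_def)
  have E: "E \<subseteq> Pow V"
    using G by (auto simp: simple_graph_def)
  let ?E = "(`) f ` E"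
  have "e \<in> {{u, v} | u v. u \<in> {0..<?n} \<and> v \<in> {0..<?n} \<and> u \<noteq> v}" if "e \<in> ?E" for e
  proof -
    obtain u v where "u \<in> V" "v \<in> V" "u \<noteq> v" "e = f ` {u, v}"
      using \<open>e \<in> ?E\<close> G by (auto simp: simple_graph_def)
    then have "f u \<in> f ` V" "f v \<in> f ` V" "f u \<noteq> f v" "e = {f u, f v}"
      using inj by (auto simp: inj_on_eq_iff)
    then show ?thesis using img by blast
  qed
  then have simple: "simple_graph {0..<?n} ?E"
    by (auto simp: simple_graph_def)
  have "k_saturated (f ` V) ?E k"
    unfolding k_saturated_def
  proof (intro conjI ballI impI)
    show "mp (f ` V) ?E \<le> k - 1"
      using sat by (simp add: mp_image[OF inj E] k_saturated_def)
  next
    fix x y assume "x \<in> f ` V" "y \<in> f ` V" and xy: "x \<noteq> y \<and> {x, y} \<notin> ?E"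
    then obtain u v where uv: "u \<in> V" "v \<in> V" "x = f u" "y = f v" by blast
    then have "u \<noteq> v" "{u, v} \<notin> E"
      using xy by (auto simp: image_iff)
    then have "k \<le> mp V (insert {u, v} E)"
      using sat uv by (simp add: k_saturated_def)
    also have "\<dots> = mp (f ` V) (insert {x, y} ?E)"
      using mp_image[OF inj, of "insert {u, v} E"] E uv by simp
    finally show "k \<le> mp (f ` V) (insert {x, y} ?E)" .
  qed
  then have "card ?E \<in> {card E | E. simple_graph {0..<?n} E \<and> k_saturated {0..<?n} E k}"
    using simple img by auto
  \<comment> \<open>\<open>Min_le\<close> needs finiteness: there are only finitely many sets of
    subsets of \<open>{0..<?n}\<close>.\<close>
  moreover have "finite {card E | E. simple_graph {0..<?n} E \<and> k_saturated {0..<?n} E k}"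
  proof (rule finite_subset)
    show "{card E | E. simple_graph {0..<?n} E \<and> k_saturated {0..<?n} E k}
        \<subseteq> card ` Pow (Pow {0..<?n})"
    proof clarify
      fix E :: "nat set set" assume "simple_graph {0..<?n} E"
      then have "E \<subseteq> Pow {0..<?n}" by (auto simp: simple_graph_def)
      then show "card E \<in> card ` Pow (Pow {0..<?n})" by blast
    qed
  qed simp
  ultimately have "h ?n k \<le> card ?E"
    unfolding h_def by (intro Min_le)
  also have "\<dots> \<le> card E"
    using finite_edges[OF G] by (rule card_image_le)
  finally show ?thesis .
qed

section \<open>Edge insertion and chains in lists\<close>

text \<open>Finiteness of the neighbourhood matters because \<open>card\<close> is 0 on infinite
  sets, where a new neighbour would not be counted.\<close>

lemma deg_insert_edge:
  assumes "finite {w. {w, v} \<in> E}" "x \<noteq> y" "{x, y} \<notin> E"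
  shows "deg (insert {x, y} E) v = deg E v + (if v = x \<or> v = y then 1 else 0)"
proof -
  consider "v = x" | "v = y" | "v \<noteq> x" "v \<noteq> y" by blast
  then show ?thesis
  proof cases
    case 1
    then have "{w. {w, v} \<in> insert {x, y} E} = insert y {w. {w, v} \<in> E}"
      by (auto simp: doubleton_eq_iff)
    with 1 assms show ?thesis by (simp add: deg_def insert_commute)
  next
    case 2
    then have "{w. {w, v} \<in> insert {x, y} E} = insert x {w. {w, v} \<in> E}"
      by (auto simp: doubleton_eq_iff)
    with 2 assms show ?thesis by (simp add: deg_def)
  next
    case 3
    then have "{w. {w, v} \<in> insert {x, y} E} = {w. {w, v} \<in> E}"
      by (auto simp: doubleton_eq_iff)
    with 3 show ?thesis by (simp add: deg_def)
  qed
qed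

text \<open>Serves to confine a path to a single clique, with the clique label as
  \<open>f\<close>.\<close>

lemma successively_imp_constant:
  assumes "successively R xs" "\<And>u v. u \<in> set xs \<Longrightarrow> v \<in> set xs \<Longrightarrow> R u v \<Longrightarrow> f u = f v"
  shows "\<exists>c. \<forall>x\<in>set xs. f x = c"
  using assms
proof (induction xs)
  case (Cons x xs)
  then obtain c where c: "\<forall>y\<in>set xs. f y = c"
    by (auto simp: successively_Cons)
  show ?case
  proof (cases xs)
    case (Cons y ys)
    then have "f x = f y"
      using Cons.prems by (auto simp: successively_Cons)
    with c Cons show ?thesis by auto
  qed simp
qed simp

lemma successively_if_pairwise:
  assumes "distinct xs" "\<And>u v. u \<in> set xs \<Longrightarrow> v \<in> set xs \<Longrightarrow> u \<noteq> v \<Longrightarrow> R u v"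
  shows "successively R xs"
  using assms
proof (induction xs)
  case (Cons x xs)
  then show ?case by (cases xs) (auto simp: successively_Cons)
qed simp

lemma sorted_map_constant: "(\<And>x. x \<in> set xs \<Longrightarrow> f x = c) \<Longrightarrow> sorted (map f xs)"
  by (induction xs) auto

section \<open>The block graph\<close>

text \<open>
  \<open>Low i b j\<close> is the vertex with index \<open>j < s\<close> of the low clique \<open>b\<close> of block \<open>i\<close>, and \<open>Mid i j\<close> the
  vertex with index \<open>j \<le> s\<close> of its middle clique; \<open>Mid 0 s\<close> is the hub.
\<close>

datatype vertex = is_Low: Low nat bool nat | Mid nat nat

text \<open>A label for the clique of a vertex: two low or two middle vertices are adjacent only if
  their labels agree.\<close>

fun cell :: "vertex \<Rightarrow> nat \<times> bool option" where
  "cell (Low i b j) = (i, Some b)"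
| "cell (Mid i j) = (i, None)"

text \<open>Between low and middle vertices, \<open>j' = j\<close> is the matching and the other two
  cases give the further neighbour. The matching misses the last middle vertex of a block; the two
  low vertices of index 0 make up for this, so that it also has at least two low neighbours.\<close>

fun adj :: "nat \<Rightarrow> vertex \<Rightarrow> vertex \<Rightarrow> bool" where
  "adj s (Low i b j) (Low i' b' j') \<longleftrightarrow> i = i' \<and> b = b' \<and> j \<noteq> j'"
| "adj s (Mid i j) (Mid i' j') \<longleftrightarrow> i = i' \<and> j \<noteq> j'"
| "adj s (Low i b j) (Mid i' j') \<longleftrightarrow>
     i = i' \<and> (j' = j \<or> j = 0 \<and> j' = s) \<or> 0 < j \<and> i' = 0 \<and> j' = s"
| "adj s (Mid i' j') (Low i b j) \<longleftrightarrow>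
     i = i' \<and> (j' = j \<or> j = 0 \<and> j' = s) \<or> 0 < j \<and> i' = 0 \<and> j' = s"

lemma adj_commute: "adj s u v \<longleftrightarrow> adj s v u"
  by (cases u; cases v) auto

locale block_graph =
  fixes s t :: nat
  assumes s_pos: "0 < s" and t_pos: "0 < t"
begin

definition V :: "vertex set" where
  "V = (\<lambda>(i, b, j). Low i b j) ` ({..<t} \<times> UNIV \<times> {..<s}) \<union> (\<lambda>(i, j). Mid i j) ` ({..<t} \<times> {..s})"

definition E :: "vertex set set" where
  "E = {{u, v} | u v. u \<in> V \<and> v \<in> V \<and> adj s u v}"

lemma Low_in_V [simp]: "Low i b j \<in> V \<longleftrightarrow> i < t \<and> j < s"
  by (auto simp: V_def image_iff)

lemma Mid_in_V [simp]: "Mid i j \<in> V \<longleftrightarrow> i < t \<and> j \<le> s"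
  by (auto simp: V_def image_iff)

lemma finite_V [simp]: "finite V"
  by (simp add: V_def)

lemma card_V: "card V = (3 * s + 1) * t"
proof -
  have "card V = card ((\<lambda>(i, b, j). Low i b j) ` ({..<t} \<times> (UNIV :: bool set) \<times> {..<s}))
      + card ((\<lambda>(i, j). Mid i j) ` ({..<t} \<times> {..s}))"
    unfolding V_def by (rule card_Un_disjoint) auto
  also have "card ((\<lambda>(i, b, j). Low i b j) ` ({..<t} \<times> (UNIV :: bool set) \<times> {..<s})) = t * (2 * s)"
    by (subst card_image) (auto simp: inj_on_def card_cartesian_product)
  also have "card ((\<lambda>(i, j). Mid i j) ` ({..<t} \<times> {..s})) = t * (s + 1)"
    by (subst card_image) (auto simp: inj_on_def card_cartesian_product)
  finally show ?thesis by (simp add: algebra_simps)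
qed

lemma edge_iff [simp]: "{u, v} \<in> E \<longleftrightarrow> u \<in> V \<and> v \<in> V \<and> adj s u v"
  by (auto simp: E_def doubleton_eq_iff adj_commute)

lemma simple_graph: "simple_graph V E"
proof -
  have "\<not> adj s u u" for u by (cases u) auto
  then have "E \<subseteq> {{u, v} | u v. u \<in> V \<and> v \<in> V \<and> u \<noteq> v}"
    unfolding E_def by blast
  then show ?thesis by (simp add: simple_graph_def)
qed

text \<open>Each block contributes two cliques on \<open>s\<close> vertices, one on
  \<open>s + 1\<close>, and two edges for each of its \<open>2 * s\<close> low vertices. An upper
  bound is enough, so the families need not be shown disjoint.\<close>

lemma card_E: "2 * card E \<le> t * s * (3 * s + 7)"
proof -
  \<comment> \<open>Pairs \<open>j' < j\<close>, one for each edge of a clique on \<open>m\<close>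
    vertices.\<close>
  let ?P = "\<lambda>m::nat. SIGMA j:{..<m}. {..<j}"
  let ?LL = "(\<lambda>(i, b, j, j'). {Low i b j, Low i b j'}) ` ({..<t} \<times> (UNIV :: bool set) \<times> ?P s)"
  let ?MM = "(\<lambda>(i, j, j'). {Mid i j, Mid i j'}) ` ({..<t} \<times> ?P (Suc s))"
  let ?LM = "(\<lambda>(i, b, j). {Low i b j, Mid i j}) ` ({..<t} \<times> (UNIV :: bool set) \<times> {..<s})"
  let ?LZ = "(\<lambda>(i, b, j). {Low i b j, Mid (if j = 0 then i else 0) s}) ` ({..<t} \<times> (UNIV :: bool set) \<times> {..<s})"
  have P: "card (?P m) = m * (m - 1) div 2" for m
    by (simp add: Sum_Ico_nat lessThan_atLeast0)
  define a b where "a = s * (s - 1) div 2" and "b = Suc s * s div 2"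
  have E_sub: "E \<subseteq> ?LL \<union> ?MM \<union> ?LM \<union> ?LZ"
  proof
    fix e assume "e \<in> E"
    then obtain u v where uv: "u \<in> V" "v \<in> V" "adj s u v" "e = {u, v}"
      by (auto simp: E_def)
    have LM: "{Low i b j, Mid i' j'} \<in> ?LM \<union> ?LZ"
      if "i < t" "j < s" "adj s (Low i b j) (Mid i' j')" for i b j i' j'
    proof (cases "i = i' \<and> j' = j")
      case True
      with that have "{Low i b j, Mid i' j'} \<in> ?LM"
        by (intro image_eqI[of _ _ "(i, b, j)"]) auto
      then show ?thesis by blast
    next
      case False
      with that have "{Low i b j, Mid i' j'} \<in> ?LZ"
        by (intro image_eqI[of _ _ "(i, b, j)"]) auto
      then show ?thesis by blast
    qed
    show "e \<in> ?LL \<union> ?MM \<union> ?LM \<union> ?LZ"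
    proof (cases u)
      case u: (Low i b j)
      show ?thesis
      proof (cases v)
        case v: (Low i' b' j')
        have "e \<in> ?LL"
          using uv u v
          by (intro image_eqI[of _ _ "(i, b, max j j', min j j')"]) (auto simp: max_def min_def)
        then show ?thesis by blast
      next
        case v: (Mid i' j')
        then show ?thesis using LM[of i j b i' j'] uv u by simp
      qed
    next
      case u: (Mid i' j')
      show ?thesis
      proof (cases v)
        case v: (Low i b j)
        then show ?thesis using LM[of i j b i' j'] uv u by (simp add: insert_commute)
      next
        case v: (Mid i j)
        have "e \<in> ?MM"
          using uv u v
          by (intro image_eqI[of _ _ "(i, max j j', min j j')"]) (auto simp: max_def min_def)
        then show ?thesis by blast
      qed
    qed
  qed
  have LL: "card ?LL \<le> t * (2 * a)"
    by (rule order.trans[OF card_image_le]) (simp_all add: card_cartesian_product P a_def del: card_SigmaI)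
  have MM: "card ?MM \<le> t * b"
    by (rule order.trans[OF card_image_le]) (simp_all add: card_cartesian_product P b_def del: card_SigmaI mult_Suc)
  have LM: "card ?LM \<le> t * (2 * s)"
    by (rule order.trans[OF card_image_le]) (simp_all add: card_cartesian_product)
  have LZ: "card ?LZ \<le> t * (2 * s)"
    by (rule order.trans[OF card_image_le]) (simp_all add: card_cartesian_product)
  have "card E \<le> card (?LL \<union> ?MM \<union> ?LM \<union> ?LZ)"
    by (rule card_mono[OF _ E_sub]) simp
  also have "\<dots> \<le> card ?LL + card ?MM + card ?LM + card ?LZ"
    by (meson card_Un_le order.trans add_mono order.refl)
  also have "\<dots> \<le> t * (2 * a) + t * b + t * (2 * s) + t * (2 * s)"
    using LL MM LM LZ by linarith
  finally have "2 * card E \<le> t * (2 * (2 * a) + 2 * b + 8 * s)"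
    by (simp add: algebra_simps)
  \<comment> \<open>The doubled count removes the divisions by 2 in \<open>a\<close> and
    \<open>b\<close>, both numerators being even.\<close>
  also have "2 * a = s * (s - 1)"
    unfolding a_def by (intro dvd_mult_div_cancel) auto
  also have "2 * b = Suc s * s"
    unfolding b_def by (intro dvd_mult_div_cancel) simp
  also have "2 * (s * (s - 1)) + Suc s * s + 8 * s = s * (3 * s + 7)"
    using s_pos by (cases s) (auto simp: algebra_simps)
  finally show ?thesis by simp
qed

section \<open>Degrees in the block graph\<close>

lemma deg_eq: "v \<in> V \<Longrightarrow> deg E v = card {u \<in> V. adj s u v}"
  by (simp add: deg_def)

lemma deg_Low:
  assumes "i < t" "j < s"
  shows "deg E (Low i b j) = s + 1"
proof -
  let ?i = "if j = 0 then i else 0"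
  have "{u \<in> V. adj s u (Low i b j)} = Low i b ` ({..<s} - {j}) \<union> {Mid i j, Mid ?i s}"
    (is "?L = ?R")
  proof (rule set_eqI)
    fix u show "u \<in> ?L \<longleftrightarrow> u \<in> ?R"
      using assms t_pos by (cases u) auto
  qed
  moreover have "card (Low i b ` ({..<s} - {j}) \<union> {Mid i j, Mid ?i s}) = (s - 1) + 2"
    using assms by (subst card_Un_disjoint) (auto simp: card_image inj_on_def)
  ultimately show ?thesis using assms by (simp add: deg_eq)
qed

lemma deg_Mid:
  assumes "i < t" "j \<le> s" "(i, j) \<noteq> (0, s)"
  shows "deg E (Mid i j) = s + 2"
proof -
  \<comment> \<open>The index of the two low neighbours: given by the matching, except that the last
    middle vertex is joined to index 0.\<close>
  let ?j = "if j = s then 0 else j"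
  have "{u \<in> V. adj s u (Mid i j)} = Mid i ` ({..s} - {j}) \<union> {Low i True ?j, Low i False ?j}"
    (is "?L = ?R")
  proof (rule set_eqI)
    fix u show "u \<in> ?L \<longleftrightarrow> u \<in> ?R"
      using assms s_pos by (cases u) auto
  qed
  moreover have "card (Mid i ` ({..s} - {j}) \<union> {Low i True ?j, Low i False ?j}) = s + 2"
    using assms by (subst card_Un_disjoint) (auto simp: card_image inj_on_def)
  ultimately show ?thesis using assms by (simp add: deg_eq)
qed

text \<open>Counts only neighbours in block 0: the rest of the middle clique, both low vertices of
  index 0 and, if \<open>s \<ge> 2\<close>, one low vertex of index 1. The resulting
  \<open>s + 3\<close> is what a middle vertex reaches after gaining an edge.\<close>

lemma deg_hub: "s + min s 2 + 1 \<le> deg E (Mid 0 s)"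
proof -
  let ?A = "Mid 0 ` {..<s} \<union> insert (Low 0 True 0) (Low 0 False ` {..<min s 2})"
  have "card ?A = s + (min s 2 + 1)"
    by (subst card_Un_disjoint) (auto simp: card_insert_if card_image inj_on_def)
  moreover have "?A \<subseteq> {u \<in> V. adj s u (Mid 0 s)}"
    using s_pos t_pos by auto
  then have "card ?A \<le> deg E (Mid 0 s)"
    using t_pos by (simp add: deg_eq card_mono)
  ultimately show ?thesis by simp
qed

lemma deg_Mid_ge:
  assumes "i < t" "j \<le> s"
  shows "s + 2 \<le> deg E (Mid i j)"
proof (cases "(i, j) = (0, s)")
  case True
  then show ?thesis using deg_hub s_pos by simp
next
  case False
  then show ?thesis using deg_Mid assms by simp
qed

section \<open>The bound on monotone paths\<close>

lemma mp_le: "mp V E \<le> 2 * s + 1"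
proof (rule mp_leI)
  have "Mid 0 0 \<in> V" using t_pos by simp
  then show "V \<noteq> {}" by blast
next
  fix p assume path: "is_path V E p" and sorted: "sorted (map (deg E) p)"
  define ls where "ls = takeWhile is_Low p"
  define ms where "ms = dropWhile is_Low p"
  have p: "p = ls @ ms" by (simp add: ls_def ms_def)
  have V: "set ls \<subseteq> V" "set ms \<subseteq> V" and dist: "distinct ls" "distinct ms"
    and succ: "successively (\<lambda>u v. {u, v} \<in> E) ls" "successively (\<lambda>u v. {u, v} \<in> E) ms"
    using path unfolding is_path_iff_successively p by (auto simp: successively_append_iff)
  have low: "is_Low u" if "u \<in> set ls" for u
    using that unfolding ls_def by (rule set_takeWhileD[THEN conjunct2])
  \<comment> \<open>The first vertex of \<open>ms\<close> is a middle vertex, of degree at least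
    \<open>s + 2\<close>; sortedness then excludes every later vertex of degree
    \<open>s + 1\<close>, so the path never returns to a low clique.\<close>
  have mid: "\<not> is_Low u" if "u \<in> set ms" for u
  proof (cases ms)
    case Nil
    with that show ?thesis by simp
  next
    case (Cons m ms')
    then have m: "\<not> is_Low m" "m \<in> V"
      using V hd_dropWhile[of is_Low p] by (auto simp: ms_def)
    then have "s + 2 \<le> deg E m"
      using deg_Mid_ge by (cases m) auto
    also have "deg E m \<le> deg E u"
      using sorted that Cons by (auto simp: p sorted_append)
    finally show ?thesis
      using V that deg_Low by (cases u) auto
  qed
  have "length ls \<le> s"
  proof -
    have "\<exists>c. \<forall>u\<in>set ls. cell u = c"
    proof (rule successively_imp_constant[OF succ(1)])
      fix u v assume "u \<in> set ls" "v \<in> set ls" "{u, v} \<in> E"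
      then show "cell u = cell v"
        using low[of u] low[of v] by (cases u rule: vertex.exhaust; cases v rule: vertex.exhaust) auto
    qed
    then obtain i b where c: "\<forall>u\<in>set ls. cell u = (i, b)" by auto
    have "set ls \<subseteq> (\<lambda>j. Low i (the b) j) ` {..<s}"
    proof
      fix u assume "u \<in> set ls"
      then show "u \<in> (\<lambda>j. Low i (the b) j) ` {..<s}"
        using c V(1) low[of u] by (cases u rule: vertex.exhaust) force+
    qed
    then have "card (set ls) \<le> card {..<s}"
      by (rule surj_card_le[rotated]) simp
    then show ?thesis using dist by (simp add: distinct_card)
  qed
  moreover have "length ms \<le> s + 1"
  proof -
    have "\<exists>c. \<forall>u\<in>set ms. cell u = c"
    proof (rule successively_imp_constant[OF succ(2)])
      fix u v assume "u \<in> set ms" "v \<in> set ms" "{u, v} \<in> E"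
      then show "cell u = cell v"
        using mid[of u] mid[of v] by (cases u rule: vertex.exhaust; cases v rule: vertex.exhaust) auto
    qed
    then obtain i b where c: "\<forall>u\<in>set ms. cell u = (i, b)" by auto
    have "set ms \<subseteq> Mid i ` {..s}"
    proof
      fix u assume "u \<in> set ms"
      then show "u \<in> Mid i ` {..s}"
        using c V(2) mid[of u] by (cases u rule: vertex.exhaust) force+
    qed
    then have "card (set ms) \<le> card {..s}"
      by (rule surj_card_le[rotated]) simp
    then show ?thesis using dist by (simp add: distinct_card)
  qed
  ultimately show "length p \<le> 2 * s + 1" by (simp add: p)
qed simp

section \<open>Paths through a low and a middle clique\<close>

lemma successively_Low:
  assumes "i < t" "distinct xs" "set xs \<subseteq> Low i b ` {..<s}"
  shows "successively (\<lambda>u v. {u, v} \<in> E) xs"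
proof (rule successively_if_pairwise[OF assms(2)])
  fix u v assume uv: "u \<in> set xs" "v \<in> set xs" "u \<noteq> v"
  then have "u \<in> Low i b ` {..<s}" "v \<in> Low i b ` {..<s}"
    using assms(3) by blast+
  with uv(3) assms(1) show "{u, v} \<in> E" by auto
qed

lemma successively_Mid:
  assumes "i < t" "distinct xs" "set xs \<subseteq> Mid i ` {..s}"
  shows "successively (\<lambda>u v. {u, v} \<in> E) xs"
proof (rule successively_if_pairwise[OF assms(2)])
  fix u v assume uv: "u \<in> set xs" "v \<in> set xs" "u \<noteq> v"
  then have "u \<in> Mid i ` {..s}" "v \<in> Mid i ` {..s}"
    using assms(3) by blast+
  with uv(3) assms(1) show "{u, v} \<in> E" by auto
qed

text \<open>All of a low clique can be traversed before any part of the middle clique, since the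
  crossing edge can be fitted to the first middle vertex. The set \<open>K\<close> allows middle
  vertices to be left out, and the end \<open>Mid i j\<close> is prescribed for attaching a further
  vertex.\<close>

lemma low_mid_path:
  assumes "i < t" "K \<subseteq> {..s}" "j \<le> s" "j \<notin> K"
  obtains ls ms where
    "set ls = Low i b ` {..<s}" "distinct ls" "length ls = s"
    "set ms = Mid i ` K" "distinct ms" "length ms = card K"
    "successively (\<lambda>u v. {u, v} \<in> E) (ls @ ms @ [Mid i j])"
proof -
  have fin: "finite K" using assms(2) finite_subset by blast
  then obtain ks where ks: "set ks = K" "distinct ks"
    using finite_distinct_list by blast
  define ms where "ms = map (Mid i) ks"
  have ms: "set ms = Mid i ` K" "distinct ms" "length ms = card K"
    using ks by (auto simp: ms_def distinct_map inj_on_def simp flip: distinct_card)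
  \<comment> \<open>The index of the first middle vertex, which is \<open>j\<close> itself when
    \<open>K\<close> is empty.\<close>
  define l where "l = hd (ks @ [j])"
  have l: "l \<le> s" "hd (ms @ [Mid i j]) = Mid i l"
    using assms ks by (cases ks; auto simp: l_def ms_def)+
  \<comment> \<open>The low vertex from which to cross: the matching partner of
    \<open>Mid i l\<close>, or index 0 for the last middle vertex.\<close>
  define l' where "l' = (if l = s then 0 else l)"
  have l': "l' < s" using l s_pos by (auto simp: l'_def)
  obtain js where js: "set js = {..<s} - {l'}" "distinct js"
    using finite_distinct_list[of "{..<s} - {l'}"] by auto
  define ls where "ls = map (Low i b) js @ [Low i b l']"
  have ls: "set ls = Low i b ` {..<s}" "distinct ls"
    using js l' by (auto simp: ls_def distinct_map inj_on_def)
  then have "length ls = s"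
    using distinct_card[of ls] by (simp add: card_image inj_on_def)
  moreover have "successively (\<lambda>u v. {u, v} \<in> E) ls"
    using ls assms(1) by (intro successively_Low) auto
  moreover have "successively (\<lambda>u v. {u, v} \<in> E) (ms @ [Mid i j])"
    using ms assms by (intro successively_Mid[of i]) auto
  moreover have "{last ls, hd (ms @ [Mid i j])} \<in> E"
    using l l' assms by (auto simp: ls_def l'_def)
  moreover have "ls \<noteq> []" by (simp add: ls_def)
  ultimately have "length ls = s" "successively (\<lambda>u v. {u, v} \<in> E) (ls @ ms @ [Mid i j])"
    by (auto simp: successively_append_iff[of _ ls])
  then show ?thesis
    using that[OF ls _ ms] by blast
qed

section \<open>Saturation\<close>

lemma k_le_mp_insert:
  assumes "x \<in> V" "y \<in> V"
    and "distinct p" "set p \<subseteq> V" "length p = 2 * s + 2"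
    and "successively (\<lambda>u v. {u, v} \<in> insert {x, y} E) p"
    and "sorted (map (deg (insert {x, y} E)) p)"
  shows "2 * s + 2 \<le> mp V (insert {x, y} E)"
proof -
  have "is_path V (insert {x, y} E) p"
    using assms by (auto simp: is_path_iff_successively)
  then show ?thesis
    using length_le_mp[of V "insert {x, y} E" p] assms by (simp add: deg_monotone_def)
qed

lemma deg_insert:
  assumes "x \<noteq> y" "{x, y} \<notin> E" "v \<in> V"
  shows "deg (insert {x, y} E) v = deg E v + (if v = x \<or> v = y then 1 else 0)"
  using assms by (intro deg_insert_edge) auto

lemma successively_insert_edge:
  "successively (\<lambda>u v. {u, v} \<in> E) p \<Longrightarrow> successively (\<lambda>u v. {u, v} \<in> insert {x, y} E) p"
  by (erule successively_mono) simp

text \<open>The clique of \<open>x\<close> ending in \<open>x\<close>, then \<open>y\<close>, then the middle clique of the block of \<open>y\<close>.\<close>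

lemma saturated_Low_Low:
  assumes "x = Low i b j" "y = Low i' b' j'" "x \<in> V" "y \<in> V" "x \<noteq> y" "{x, y} \<notin> E"
  shows "2 * s + 2 \<le> mp V (insert {x, y} E)"
proof -
  let ?E = "insert {x, y} E"
  have ij: "i < t" "j < s" "i' < t" "j' < s" and ne: "(i, b) \<noteq> (i', b')"
    using assms by auto
  obtain js where js: "set js = {..<s} - {j}" "distinct js"
    using finite_distinct_list[of "{..<s} - {j}"] by auto
  obtain ks where ks: "set ks = {..<s} - {j'}" "distinct ks"
    using finite_distinct_list[of "{..<s} - {j'}"] by auto
  have len: "length js = s - 1" "length ks = s - 1"
    using js ks ij distinct_card[of js] distinct_card[of ks] by auto
  let ?p1 = "map (Low i b) js @ [x]"
  \<comment> \<open>The path enters by the matching edge at \<open>y\<close>.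
    \<open>Mid i' s\<close> is put last because in block 0 it is the hub, whose degree may exceed
    \<open>s + 2\<close>.\<close>
  let ?p2 = "Mid i' j' # map (Mid i') ks @ [Mid i' s]"
  let ?p = "?p1 @ y # ?p2"
  have d: "deg ?E v = deg E v" if "v \<in> V" "v \<noteq> x" "v \<noteq> y" for v
    using deg_insert[of x y v] assms that by simp
  show ?thesis
  proof (rule k_le_mp_insert[of _ _ ?p])
    show "distinct ?p"
      using js ks ij ne assms by (auto simp: distinct_map inj_on_def)
    show "set ?p \<subseteq> V"
      using ij assms(3,4) by (simp add: js(1) ks(1) image_subset_iff)
    show "length ?p = 2 * s + 2"
      using len s_pos by simp
    have "distinct ?p1" "set ?p1 = Low i b ` {..<s}"
      using js ij(2) assms(1) by (auto simp: distinct_map inj_on_def)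
    then have "successively (\<lambda>u v. {u, v} \<in> E) ?p1"
      using ij(1) by (intro successively_Low[of i _ b]) simp_all
    moreover have "{..s} = insert j' (insert s ({..<s} - {j'}))"
      using ij(4) by auto
    then have "distinct ?p2" "set ?p2 = Mid i' ` {..s}"
      using ks(2) ij(4) by (simp_all add: ks(1) distinct_map inj_on_def image_iff insert_commute)
    then have "successively (\<lambda>u v. {u, v} \<in> E) ?p2"
      using ij(3) by (intro successively_Mid[of i']) simp_all
    then have "successively (\<lambda>u v. {u, v} \<in> E) (y # ?p2)"
      using assms ij by (simp add: successively_Cons)
    ultimately have "successively (\<lambda>u v. {u, v} \<in> ?E) ?p1"
      "successively (\<lambda>u v. {u, v} \<in> ?E) (y # ?p2)"
      by (blast intro: successively_insert_edge)+
    then show "successively (\<lambda>u v. {u, v} \<in> ?E) ?p"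
      by (subst successively_append_iff) simp
    have low: "deg ?E (Low i b l) = s + 1" if "l \<in> set js" for l
      using d[of "Low i b l"] deg_Low[of i l b] ij ne assms(1,2) js(1) that by auto
    have xy: "deg ?E x = s + 2" "deg ?E y = s + 2"
      using deg_insert[of x y] deg_Low ij assms by simp_all
    have mid: "deg ?E (Mid i' l) = s + 2" if "l \<in> insert j' (set ks)" for l
    proof -
      have "l < s" using that ij(4) by (simp add: ks(1)) blast
      then show ?thesis
        using d[of "Mid i' l"] deg_Mid[of i' l] ij(3) assms(1,2) by simp
    qed
    have hub: "s + 2 \<le> deg ?E (Mid i' s)"
      using d[of "Mid i' s"] deg_Mid_ge[of i' s] ij assms(1,2) by simp
    have "sorted (map (\<lambda>l. deg ?E (Low i b l)) js)"
      using low by (rule sorted_map_constant)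
    moreover have "sorted (map (\<lambda>l. deg ?E (Mid i' l)) ks)"
      using mid by (intro sorted_map_constant) blast
    moreover have "s + 1 \<le> deg ?E (Mid i' s)"
      using hub by simp
    ultimately show "sorted (map (deg ?E) ?p)"
      using low mid xy hub by (simp add: sorted_append comp_def)
  qed (use assms in auto)
qed

text \<open>
  The other low clique of the block of \<open>x\<close>, then the middle clique ending in the neighbour of \<open>x\<close>,
  then \<open>x\<close>; if \<open>y\<close> or the hub belongs to that middle clique, it is postponed until after \<open>x\<close>, because
  its degree exceeds that of \<open>x\<close>.
\<close>

lemma saturated_Low_Mid:
  assumes "x = Low i b j" "y = Mid i' j'" "x \<in> V" "y \<in> V" "{x, y} \<notin> E"
  shows "2 * s + 2 \<le> mp V (insert {x, y} E)"
proof -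
  let ?E = "insert {x, y} E"
  \<comment> \<open>Existing edges exclude two choices of \<open>y\<close>: the matching partner of
    \<open>x\<close>, and the hub if \<open>x\<close> is in block 0, where every low vertex is
    joined to the hub.\<close>
  have ij: "i < t" "j < s" "i' < t" "j' \<le> s" and ne: "(i', j') \<noteq> (i, j)"
    and hub: "i = 0 \<Longrightarrow> (i', j') \<noteq> (0, s)"
    using assms by auto
  define Y where "Y = (if i' = i then [y] else [])"
  define Z where "Z = (if i = 0 then [Mid 0 s] else [])"
  \<comment> \<open>The middle vertices to be visited before \<open>Mid i j\<close>; together with
    \<open>Y\<close>, \<open>Z\<close> and \<open>Mid i j\<close> they exhaust the middle clique of
    block \<open>i\<close>.\<close>
  define K where "K = {..s} - {j} - (if i' = i then {j'} else {}) - (if i = 0 then {s} else {})"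
  have card_K: "card K + length Y + length Z = s"
    using ij ne hub s_pos by (auto simp: K_def Y_def Z_def)
  have K: "K \<subseteq> {..s}" "j \<notin> K" by (auto simp: K_def)
  obtain ls ms where
    ls: "set ls = Low i (\<not> b) ` {..<s}" "distinct ls" "length ls = s" and
    ms: "set ms = Mid i ` K" "distinct ms" "length ms = card K" and
    succ: "successively (\<lambda>u v. {u, v} \<in> E) (ls @ ms @ [Mid i j])"
    by (rule low_mid_path[OF ij(1) K(1) less_imp_le[OF ij(2)] K(2), of "\<not> b"])
  let ?q = "ls @ ms @ [Mid i j]"
  let ?p = "?q @ x # Y @ Z"
  have d: "deg ?E v = deg E v" if "v \<in> V" "v \<noteq> x" "v \<noteq> y" for v
    using deg_insert[of x y v] assms that by simp
  show ?thesis
  proof (rule k_le_mp_insert[of _ _ ?p])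
    show "distinct ?p"
      using ls(1,2) ms(1,2) ij ne hub assms by (auto simp: K_def Y_def Z_def)
    show "set ?p \<subseteq> V"
    proof -
      have "set Y \<subseteq> V" "set Z \<subseteq> V"
        using assms(4) t_pos by (auto simp: Y_def Z_def)
      then show ?thesis
        using ij assms(3) by (simp add: ls(1) ms(1) image_subset_iff K_def)
    qed
    show "length ?p = 2 * s + 2"
      using ls ms card_K by simp
    \<comment> \<open>From \<open>x\<close> the path continues to \<open>y\<close> by the new edge
      if \<open>Y\<close> is nonempty, and otherwise to the hub, if present, by an old edge.\<close>
    have "successively (\<lambda>u v. {u, v} \<in> ?E) (x # Y @ Z)"
      using assms ij hub by (auto simp: Y_def Z_def)
    moreover have "{Mid i j, x} \<in> ?E"
      using assms ij by auto
    ultimately show "successively (\<lambda>u v. {u, v} \<in> ?E) ?p"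
      using successively_insert_edge[OF succ]
      by (subst successively_append_iff) auto
    have "deg ?E u = s + 1" if u: "u \<in> set ls" for u
    proof -
      obtain l where "u = Low i (\<not> b) l" "l < s"
        using u ls(1) by auto
      then show ?thesis
        using d[of u] deg_Low[of i l "\<not> b"] ij assms(1,2) by simp
    qed
    then have "sorted (map (deg ?E) ls)" and "\<And>u. u \<in> set ls \<Longrightarrow> deg ?E u = s + 1"
      by (auto intro: sorted_map_constant)
    moreover have "deg ?E u = s + 2" if u: "u \<in> insert (Mid i j) (set ms)" for u
    proof -
      obtain l where "u = Mid i l" "l \<le> s" "(i, l) \<noteq> (i', j')" "(i, l) \<noteq> (0, s)"
        using u ms(1) ij ne by (auto simp: K_def split: if_splits)
      then show ?thesis
        using d[of u] deg_Mid[of i l] ij assms(1,2) by auto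
    qed
    then have "sorted (map (deg ?E) ms)" "deg ?E (Mid i j) = s + 2"
      and "\<And>u. u \<in> set ms \<Longrightarrow> deg ?E u = s + 2"
      by (auto intro: sorted_map_constant)
    moreover have "deg ?E x = s + 2"
      using deg_insert[of x y x] deg_Low[of i j b] ij assms by simp
    moreover have YZ: "s + 2 \<le> deg ?E u" if u: "u \<in> set Y \<union> set Z" for u
    proof -
      obtain l where "u = Mid i l" "l \<le> s"
        using u assms(2) ij(4) by (auto simp: Y_def Z_def split: if_splits)
      then show ?thesis
        using deg_insert[of x y u] deg_Mid_ge[of i l] ij assms by simp
    qed
    moreover have "s + 1 \<le> deg ?E u" if "u \<in> set Y \<union> set Z" for u
      using YZ[OF that] by simp
    \<comment> \<open>When both are postponed, \<open>y\<close> precedes the hub. Here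
      \<open>j\<close> and \<open>j'\<close> are distinct indices below \<open>s\<close>, so
      \<open>s \<ge> 2\<close> and the hub has degree at least \<open>s + 3\<close>, the new degree
      of \<open>y\<close>.\<close>
    moreover have "deg ?E y \<le> deg ?E (Mid 0 s)" if "i' = i" "i = 0"
    proof -
      have j': "j' \<noteq> s" using hub that by simp
      then have "2 \<le> s" using ne that ij by auto
      moreover have "deg ?E y = s + 3"
        using deg_insert[of x y y] assms deg_Mid[of i' j'] ij j' by simp
      moreover have "deg ?E (Mid 0 s) = deg E (Mid 0 s)"
        using d[of "Mid 0 s"] t_pos assms(1,2) j' by simp
      ultimately show ?thesis using deg_hub by simp
    qed
    ultimately show "sorted (map (deg ?E) ?p)"
      by (auto simp: sorted_append Y_def Z_def)
  qed (use assms in auto)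
qed

text \<open>
  A low and the middle clique of the block of \<open>x\<close> ending in \<open>x\<close>, then \<open>y\<close>. Block 0 is excluded since its
  hub would have to come after \<open>x\<close>.
\<close>

lemma saturated_Mid_Mid:
  assumes "x = Mid i j" "y = Mid i' j'" "x \<in> V" "y \<in> V" "x \<noteq> y" "{x, y} \<notin> E" "i \<noteq> 0"
  shows "2 * s + 2 \<le> mp V (insert {x, y} E)"
proof -
  let ?E = "insert {x, y} E"
  have ij: "i < t" "j \<le> s" "i' < t" "j' \<le> s" and ne: "i' \<noteq> i"
    using assms by auto
  let ?K = "{..s} - {j}"
  obtain ls ms where
    ls: "set ls = Low i True ` {..<s}" "distinct ls" "length ls = s" and
    ms: "set ms = Mid i ` ?K" "distinct ms" "length ms = card ?K" and
    succ: "successively (\<lambda>u v. {u, v} \<in> E) (ls @ ms @ [x])"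
    unfolding assms(1) by (rule low_mid_path[OF ij(1) _ ij(2), of ?K True]) auto
  let ?q = "ls @ ms @ [x]"
  let ?p = "?q @ [y]"
  have d: "deg ?E v = deg E v + (if v = x \<or> v = y then 1 else 0)" if "v \<in> V" for v
    using assms that by (intro deg_insert) auto
  show ?thesis
  proof (rule k_le_mp_insert[of _ _ ?p])
    show "distinct ?p"
      using ls(1,2) ms(1,2) ij ne assms by auto
    show "set ?p \<subseteq> V"
      using ls(1) ms(1) ij assms by auto
    show "length ?p = 2 * s + 2"
      using ls ms ij by simp
    show "successively (\<lambda>u v. {u, v} \<in> ?E) ?p"
      using successively_insert_edge[OF succ]
      by (subst successively_append_iff) auto
    have "deg ?E u = s + 1" if "u \<in> set ls" for u
      using that d ls(1) ij deg_Low assms by auto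
    then have "sorted (map (deg ?E) ls)" and "\<And>u. u \<in> set ls \<Longrightarrow> deg ?E u = s + 1"
      by (auto intro: sorted_map_constant)
    \<comment> \<open>The block of \<open>x\<close> contains neither the hub, as
      \<open>i \<noteq> 0\<close>, nor \<open>y\<close>, as \<open>i' \<noteq> i\<close>.\<close>
    moreover have "deg ?E u = s + 2" if "u \<in> set ms" for u
      using that d ms(1) ij deg_Mid ne assms by auto
    then have "sorted (map (deg ?E) ms)" and "\<And>u. u \<in> set ms \<Longrightarrow> deg ?E u = s + 2"
      by (auto intro: sorted_map_constant)
    moreover have "deg ?E x = s + 3"
      using d deg_Mid assms by auto
    moreover have "s + 3 \<le> deg ?E y"
      using d[of y] deg_Mid_ge[of i' j'] assms by auto
    ultimately show "sorted (map (deg ?E) ?p)"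
      by (auto simp: sorted_append)
  qed (use assms in auto)
qed

lemma k_saturated: "k_saturated V E (2 * s + 2)"
  unfolding k_saturated_def
proof (intro conjI ballI impI)
  show "mp V E \<le> 2 * s + 2 - 1" using mp_le by simp
next
  fix x y assume V: "x \<in> V" "y \<in> V" and xy: "x \<noteq> y \<and> {x, y} \<notin> E"
  then have yx: "{y, x} \<notin> E" by (simp add: insert_commute)
  show "2 * s + 2 \<le> mp V (insert {x, y} E)"
  proof (cases x)
    case x: (Low i b j)
    show ?thesis
    proof (cases y)
      case (Low i' b' j')
      then show ?thesis using saturated_Low_Low[OF x] V xy by blast
    next
      case (Mid i' j')
      then show ?thesis using saturated_Low_Mid[OF x] V xy by blast
    qed
  next
    case x: (Mid i j)
    show ?thesis
    proof (cases y)
      case y: (Low i' b' j')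
      then show ?thesis
        using saturated_Low_Mid[OF y x V(2) V(1) yx] by (simp add: insert_commute)
    next
      case y: (Mid i' j')
      \<comment> \<open>Two distinct middle vertices of block 0 would be adjacent, so one of them
        lies in another block and can take the role of \<open>x\<close>.\<close>
      then have "i \<noteq> 0 \<or> i' \<noteq> 0" using x V xy by auto
      then show ?thesis
      proof
        assume "i \<noteq> 0"
        then show ?thesis using saturated_Mid_Mid[OF x y] V xy by blast
      next
        assume "i' \<noteq> 0"
        then have "2 * s + 2 \<le> mp V (insert {y, x} E)"
          using saturated_Mid_Mid[OF y x] V xy yx by blast
        then show ?thesis by (simp add: insert_commute)
      qed
    qed
  qed
qed

end

section \<open>The bound in terms of \<open>n\<close> and \<open>k\<close>\<close>

theorem theorem2p7:
  fixes n k :: nat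
  assumes "even k" and "4 \<le> k" and "0 < n" and "((3 * k - 4) div 2) dvd n"
  shows "real (h n k) \<le> real n * (3 * real k + 8) * (real k - 2) / (4 * (3 * real k - 4))"
proof -
  obtain m where "k = 2 * m" using assms(1) by blast
  define s where "s = m - 1"
  have k: "k = 2 * s + 2" and s: "0 < s"
    using assms(2) \<open>k = 2 * m\<close> by (auto simp: s_def)
  have "(3 * k - 4) div 2 = 3 * s + 1" by (simp add: k)
  then obtain t where n: "n = (3 * s + 1) * t"
    using assms(4) by (auto simp: dvd_def)
  then have t: "0 < t" using assms(3) by auto
  interpret block_graph s t using s t by unfold_locales
  have "h n k \<le> card E"
    using h_le_card_edges[OF simple_graph k_saturated] by (simp add: card_V n k)
  then have "2 * h n k \<le> t * s * (3 * s + 7)"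
    using card_E by linarith
  then have "real (2 * h n k) \<le> real (t * s * (3 * s + 7))"
    by (rule of_nat_mono)
  then have "real (h n k) \<le> real t * real s * (3 * real s + 7) / 2"
    by simp
  \<comment> \<open>With \<open>k = 2 * s + 2\<close> one has
    \<open>3 * k + 8 = 2 * (3 * s + 7)\<close>, \<open>k - 2 = 2 * s\<close> and
    \<open>3 * k - 4 = 2 * (3 * s + 1)\<close>; the last cancels against the factor
    \<open>3 * s + 1\<close> of \<open>n\<close>.\<close>
  also have "\<dots> = real n * (3 * real k + 8) * (real k - 2) / (4 * (3 * real k - 4))"
  proof -
    have "3 * real s + 1 \<noteq> 0" by linarith
    then show ?thesis by (simp add: n k field_simps)
  qed
  finally show ?thesis .
qed

end
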